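(* Let $C=(c_{ij})$ and $C'=(c'_{ij})$ be real $n\times n$ matrices with row-sum vectors $(r_1,\ldots,r_n)$ and $(r'_1,\ldots,r'_n)$ respectively. Assume: (i) $c_{ij}\leq c'_{ij}$ for all $1\leq i\leq n$, $1\leq j\leq n-1$, and $r_i\leq r'_i$ for all $1\leq i\leq n$; (ii) $C'$ has a rooted eigenvector $v'=(v'_1,\ldots,v'_n)^T$ for an eigenvalue $\lambda'\in\mathbb{R}$; (iii) $C$ has a nonnegative left eigenvector $v^T=(v_1,\ldots,v_n)$ for an eigenvalue $\lambda\in\mathbb{R}$; (iv) $v^Tv'>0$. Then $\lambda\leq\lambda'$. Moreover, $\lambda=\lambda'$ if and only if both of the following hold: (a) if $v'_n\neq 0$, then $r_i=r'_i$ for all $1\le i\le n$ with $v_i\neq0$; (b) $c'_{ij}=c_{ij}$ for all $1\leq i\leq n$, $1\leq j\leq n-1$ with $v_i\neq 0$ and $v'_j>v'_n$.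
   Context: A real vector $(v_1,\ldots,v_n)$ is rooted if $v_i\geq v_n\geq 0$ for all $1\leq i\leq n-1$. The row-sum vector of a matrix is the vector of its row sums. *)

theory Defs
  imports "Jordan_Normal_Form.Char_Poly"
begin

text \<open>Vectors and matrices are indexed from 0, so the last entry of a vector \<open>v\<close> of
  dimension \<open>n\<close> is \<open>v $ (n - 1)\<close>.\<close>

definition rooted :: "real vec \<Rightarrow> bool" where
  "rooted v \<longleftrightarrow> 0 < dim_vec v
     \<and> (\<forall>i < dim_vec v - 1. v $ (dim_vec v - 1) \<le> v $ i)
     \<and> 0 \<le> v $ (dim_vec v - 1)"

definition row_sum_vec :: "real mat \<Rightarrow> real vec" where
  "row_sum_vec A = vec (dim_row A) (\<lambda>i. \<Sum>j < dim_col A. A $$ (i, j))"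

definition left_eigenvector :: "real mat \<Rightarrow> real vec \<Rightarrow> real \<Rightarrow> bool" where
  "left_eigenvector A v k \<longleftrightarrow> v \<in> carrier_vec (dim_row A) \<and> v \<noteq> 0\<^sub>v (dim_row A)
     \<and> mat_of_row v * A = k \<cdot>\<^sub>m mat_of_row v"

lemma left_eigenvector_transpose:
  assumes "A \<in> carrier_mat n n"
  shows "left_eigenvector A v k \<longleftrightarrow> eigenvector (transpose_mat A) v k"
proof -
  have "mat_of_row v * A = k \<cdot>\<^sub>m mat_of_row v \<longleftrightarrow> transpose_mat A *\<^sub>v v = k \<cdot>\<^sub>v v"
    if v: "v \<in> carrier_vec n"
  proof -
    have "mat_of_row v * A = k \<cdot>\<^sub>m mat_of_row v \<longleftrightarrow> (\<forall>j<n. v \<bullet> col A j = k * v $ j)"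
      using assms v by (auto simp: mat_eq_iff)
    also have "\<dots> \<longleftrightarrow> (\<forall>j<n. col A j \<bullet> v = k * v $ j)"
      using assms v by (metis carrier_matD(1) col_dim comm_scalar_prod)
    also have "\<dots> \<longleftrightarrow> transpose_mat A *\<^sub>v v = k \<cdot>\<^sub>v v"
      using assms v by (auto simp: vec_eq_iff)
    finally show ?thesis .
  qed
  then show ?thesis
    using assms by (auto simp: left_eigenvector_def eigenvector_def)
qed

end

theory Submission
  imports Defs
begin

text \<open>Pairing \<open>C' v'\<close> and \<open>v\<^sup>T C\<close> gives \<open>(l' - l) (v \<bullet> v') = v \<bullet> ((C' - C) v')\<close>. Splitting
  \<open>v'\<close> into its last entry times the all-ones vector plus a nonnegative remainder
  that vanishes in the last coordinate, each entry of \<open>(C' - C) v'\<close> becomes a sum of the nonnegative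
  terms \<open>(c'\<^sub>i\<^sub>j - c\<^sub>i\<^sub>j) (v'\<^sub>j - v'\<^sub>n)\<close> and \<open>v'\<^sub>n (r'\<^sub>i - r\<^sub>i)\<close>.
  Equality of the eigenvalues forces every such term with \<open>v\<^sub>i \<noteq> 0\<close> to vanish.\<close>

text \<open>Write \<open>x j\<close> as \<open>(x j - x (n-1)) + x (n-1)\<close>: the difference is
  0 at \<open>j = n-1\<close>, so the first sum may stop early. Thus \<open>a (n-1)\<close> enters
  only through the total, which for a matrix row is the row sum.\<close>

lemma sum_mult_split_last:
  fixes a x :: "nat \<Rightarrow> 'a :: comm_ring"
  assumes "1 \<le> n"
  shows "(\<Sum>j<n. a j * x j) = (\<Sum>j<n-1. a j * (x j - x (n-1))) + x (n-1) * (\<Sum>j<n. a j)"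
proof -
  obtain m where "n = Suc m"
    using assms by (cases n) auto
  then show ?thesis
    by (simp add: algebra_simps sum_subtractf sum_distrib_left)
qed

lemma scalar_prod_lessThan:
  "w \<in> carrier_vec n \<Longrightarrow> u \<bullet> w = (\<Sum>i<n. u $ i * w $ i)"
  by (auto simp: scalar_prod_def lessThan_atLeast0)

lemma eigenvalue_diff_scalar_prod:
  fixes A B :: "real mat"
  assumes A: "A \<in> carrier_mat n n" and B: "B \<in> carrier_mat n n"
    and w: "eigenvector B w m" and v: "left_eigenvector A v k"
  shows "(m - k) * (v \<bullet> w) = (\<Sum>i<n. v $ i * (\<Sum>j<n. (B $$ (i, j) - A $$ (i, j)) * w $ j))"
proof -
  have w': "w \<in> carrier_vec n" "B *\<^sub>v w = m \<cdot>\<^sub>v w"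
    using w B by (auto simp: eigenvector_def)
  have v': "v \<in> carrier_vec n" "transpose_mat A *\<^sub>v v = k \<cdot>\<^sub>v v"
    using v A by (auto simp: left_eigenvector_transpose[OF A] eigenvector_def)
  \<comment> \<open>A scalar product sums up to the dimension of its second argument, here fixed to
    \<open>n\<close>.\<close>
  have Aw: "A *\<^sub>v w \<in> carrier_vec n" and Bw: "B *\<^sub>v w \<in> carrier_vec n"
    using A B w' by auto
  have "m * (v \<bullet> w) = v \<bullet> (B *\<^sub>v w)"
    using v' w' by simp
  \<comment> \<open>Transposing moves \<open>A\<close> from \<open>v\<close> onto
    \<open>w\<close>.\<close>
  moreover have "k * (v \<bullet> w) = v \<bullet> (A *\<^sub>v w)"
    using transpose_vec_mult_scalar[OF A w'(1) v'(1)] v' w' by simp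
  ultimately have "(m - k) * (v \<bullet> w) = v \<bullet> (B *\<^sub>v w) - v \<bullet> (A *\<^sub>v w)"
    by (simp add: left_diff_distrib)
  also have "\<dots> = (\<Sum>i<n. v $ i * ((B *\<^sub>v w) $ i - (A *\<^sub>v w) $ i))"
    by (simp add: scalar_prod_lessThan[OF Aw] scalar_prod_lessThan[OF Bw]
        sum_subtractf right_diff_distrib)
  also have "\<dots> = (\<Sum>i<n. v $ i * (\<Sum>j<n. (B $$ (i, j) - A $$ (i, j)) * w $ j))"
    using A B w'(1)
    by (intro sum.cong refl)
       (simp add: scalar_prod_lessThan[OF w'(1)] sum_subtractf left_diff_distrib)
  finally show ?thesis .
qed

theorem theorem3p4:
  fixes n :: nat and C C' :: "real mat" and r r' v v' :: "real vec" and l l' :: real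
  assumes n: "1 \<le> n"
    and C: "C \<in> carrier_mat n n" and C': "C' \<in> carrier_mat n n"
    and r: "r = row_sum_vec C" and r': "r' = row_sum_vec C'"
    and entries_le: "\<forall>i<n. \<forall>j<n-1. C $$ (i, j) \<le> C' $$ (i, j)"
    and row_sums_le: "\<forall>i<n. r $ i \<le> r' $ i"
    and v'_eigen: "eigenvector C' v' l'" and v'_rooted: "rooted v'"
    and v_eigen: "left_eigenvector C v l" and v_nonneg: "\<forall>i<n. 0 \<le> v $ i"
    and vv'_pos: "v \<bullet> v' > 0"
  shows "l \<le> l' \<and>
    (l = l' \<longleftrightarrow>
      (v' $ (n-1) \<noteq> 0 \<longrightarrow> (\<forall>i<n. v $ i \<noteq> 0 \<longrightarrow> r $ i = r' $ i)) \<and>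
      (\<forall>i<n. \<forall>j<n-1. v $ i \<noteq> 0 \<and> v' $ j > v' $ (n-1) \<longrightarrow> C' $$ (i, j) = C $$ (i, j)))"
proof -
  let ?w = "v' $ (n-1)"
  let ?e = "\<lambda>i j. (C' $$ (i, j) - C $$ (i, j)) * (v' $ j - ?w)"
  let ?d = "\<lambda>i. (\<Sum>j<n-1. ?e i j) + ?w * (r' $ i - r $ i)"
  have "dim_vec v' = n"
    using v'_eigen C' by (auto simp: eigenvector_def)
  then have root: "0 \<le> ?w" "\<And>j. j < n-1 \<Longrightarrow> ?w \<le> v' $ j"
    using v'_rooted by (auto simp: rooted_def)
  have e_nonneg: "0 \<le> ?e i j" if "i < n" "j < n-1" for i j
    using that root entries_le by simp
  have r_nonneg: "0 \<le> ?w * (r' $ i - r $ i)" if "i < n" for i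
    using that root row_sums_le by simp
  have s_nonneg: "0 \<le> (\<Sum>j<n-1. ?e i j)" if "i < n" for i
    by (intro sum_nonneg e_nonneg) (use that in auto)
  have vd_nonneg: "0 \<le> v $ i * ?d i" if "i < n" for i
    using v_nonneg that by (intro mult_nonneg_nonneg add_nonneg_nonneg[OF s_nonneg r_nonneg]) auto
  \<comment> \<open>The total of row \<open>i\<close> of \<open>C' - C\<close> is
    \<open>r' $ i - r $ i\<close>.\<close>
  have d_eq: "(\<Sum>j<n. (C' $$ (i, j) - C $$ (i, j)) * v' $ j) = ?d i" if "i < n" for i
    using that C C' r r'
    by (subst sum_mult_split_last[OF n]) (simp add: row_sum_vec_def sum_subtractf)
  have key: "(l' - l) * (v \<bullet> v') = (\<Sum>i<n. v $ i * ?d i)"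
    unfolding eigenvalue_diff_scalar_prod[OF C C' v'_eigen v_eigen]
    by (intro sum.cong refl) (simp add: d_eq)
  have "0 \<le> (l' - l) * (v \<bullet> v')"
    unfolding key by (intro sum_nonneg vd_nonneg) auto
  then have le: "l \<le> l'"
    using vv'_pos by (simp add: zero_le_mult_iff)
  have "l = l' \<longleftrightarrow> (l' - l) * (v \<bullet> v') = 0"
    using vv'_pos by auto
  also have "\<dots> \<longleftrightarrow> (\<forall>i<n. v $ i * ?d i = 0)"
    unfolding key by (subst sum_nonneg_eq_0_iff) (use vd_nonneg in auto)
  also have "\<dots> \<longleftrightarrow> (\<forall>i<n. v $ i \<noteq> 0 \<longrightarrow> ?w * (r' $ i - r $ i) = 0 \<and> (\<forall>j<n-1. ?e i j = 0))"
  proof -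
    have "?d i = 0 \<longleftrightarrow> ?w * (r' $ i - r $ i) = 0 \<and> (\<forall>j<n-1. ?e i j = 0)" if "i < n" for i
    proof -
      have "(\<Sum>j<n-1. ?e i j) = 0 \<longleftrightarrow> (\<forall>j<n-1. ?e i j = 0)"
        by (subst sum_nonneg_eq_0_iff) (use that e_nonneg in auto)
      then show ?thesis
        using add_nonneg_eq_0_iff[OF s_nonneg[OF that] r_nonneg[OF that]] by blast
    qed
    then show ?thesis
      \<comment> \<open>The instantiation splits only products led by an entry of \<open>v\<close>,
        keeping those inside \<open>?d i\<close> intact.\<close>
      unfolding mult_eq_0_iff[of "v $ _"] by blast
  qed
  also have "\<dots> \<longleftrightarrow>
      (?w \<noteq> 0 \<longrightarrow> (\<forall>i<n. v $ i \<noteq> 0 \<longrightarrow> r $ i = r' $ i)) \<and>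
      (\<forall>i<n. \<forall>j<n-1. v $ i \<noteq> 0 \<and> v' $ j > ?w \<longrightarrow> C' $$ (i, j) = C $$ (i, j))"
  proof -
    \<comment> \<open>Rootedness excludes \<open>v' $ j < ?w\<close>, so a nonzero second factor of
      \<open>?e i j\<close> means \<open>v' $ j > ?w\<close>.\<close>
    have "?e i j = 0 \<longleftrightarrow> (v' $ j > ?w \<longrightarrow> C' $$ (i, j) = C $$ (i, j))" if "j < n-1" for i j
      using root(2)[OF that] by auto
    moreover have "?w * (r' $ i - r $ i) = 0 \<longleftrightarrow> (?w \<noteq> 0 \<longrightarrow> r $ i = r' $ i)" for i
      by auto
    ultimately show ?thesis
      by blast
  qed
  finally show ?thesis
    using le by blast
qed

end
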